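(* Let $\zeta(0)=0$, and for $t\in K_x$, $t\neq0$, written in the form $t=x^{-n}(\theta_0+\theta_1x+\theta_2x^2+\cdots)$ with $n\in\{1,2,\ldots\}$ and $\theta_j\in\mathbf F_q$ (where $\theta_0=0$ is allowed), let $$\zeta(t)=\left(\Delta^{(\theta_0+\theta_1x+\theta_2x^2+\cdots)}l_n\right)(1).$$ Then $\zeta(t)$ is well defined (the value does not depend on the choice of $n$ in such a representation of $t$), $\zeta(x^{-n})=l_n(1)$ for $n=1,2,\ldots$, and $\zeta$ is a continuous $\mathbf F_q$-linear function on $K_x$ with values in $\Omega_x$.
   Context: Let $\mathbf F_q$ be the finite field with $q$ elements. Let $|\cdot|_x$ be the $x$-adic absolute value on $\mathbf F_q(x)$ with $|x|_x=q^{-1}$, $K_x=\mathbf F_q((x))$ the completion, $\Omega_x$ the completion of an algebraic closure of $K_x$, and $O_x=\{t\in K_x:\ |t|_x\le1\}=\mathbf F_q[[x]]$. A function $f$ on an $\mathbf F_q$-subspace of $K_x$ with values in $\Omega_x$ is $\mathbf F_q$-linear if it is additive and $f(\alpha t)=\alpha f(t)$ for $\alpha\in\mathbf F_q$. Operators: $(\Delta u)(t)=u(xt)-xu(t)$; $(du)(t)=\big((\Delta u)(t)\big)^{1/q}$ (the unique $q$-th root in $\Omega_x$); $(\tau u)(t)=u(t)^q$. Notation: $[n]=x^{q^n}-x$ for $n\ge1$. Polylogarithms: $l_1:O_x\to\Omega_x$ is a fixed continuous $\mathbf F_q$-linear solution $u=l_1$ of $(1-\tau)du(t)=t$ (that is,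 $du(t)-\Delta u(t)=t$) on $O_x$ coinciding with $\sum_{j=1}^\infty t^{q^j}/[j]$ for $|t|_x\le q^{-1}$; such solutions exist (there are exactly $q$ of them). For $n\ge2$, $l_n:O_x\to\Omega_x$ is, recursively, the unique continuous $\mathbf F_q$-linear solution of $\Delta l_n=l_{n-1}$ on $O_x$ coinciding with $\sum_{j=1}^\infty t^{q^j}/[j]^n$ for $|t|_x\le q^{-1}$ (existence and uniqueness are known). Fractional derivatives: the hyperdifferentiations $\mathcal D_k$, $k\ge0$, are defined on monomials by $\mathcal D_k(x^n)=\binom nk x^{n-k}$ (with $\binom nk=0$ for $k>n$), extended to $\mathbf F_q[x]$ by $\mathbf F_q$-linearity and to $O_x$ by continuity. For $\alpha=\sum_{n\ge0}\alpha_nx^n\in O_x$, $\alpha_n\in\mathbf F_q$, put $\widehat\alpha=\sum_{n\ge0}(-1)^n\alpha_nx^n$. For a continuous $\mathbf F_q$-linear function $u:O_x\to\Omega_x$ and $t\in O_x$, $$\left(\Delta^{(\alpha)}u\right)(t)=\sum_{k=0}^\infty(-1)^k\mathcal D_k(\widehat\alpha)\,u(x^kt).$$ *)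

theory Defs
  imports
    "HOL-Analysis.Analysis"
    "HOL-Algebra.Algebraic_Closure_Type"
begin

text \<open>
  Conventions: a finite field type \<open>'a\<close> plays the role of \<open>F_q\<close>, with \<open>q = CARD('a)\<close>;
  \<open>'a fls\<close> is \<open>K_x = F_q((x))\<close> and \<open>'a fps\<close> is its ring of integers \<open>O_x = F_q[[x]]\<close>,
  included in \<open>K_x\<close> by \<^const>\<open>fps_to_fls\<close>. The library metrics on these two types
  (with base 2 instead of \<open>q\<close>) induce the \<open>x\<close>-adic topology.
\<close>

definition abs_x :: "'a::{field,finite} fls \<Rightarrow> real" where
  "abs_x f = (if f = 0 then 0 else real CARD('a) powi (- fls_subdegree f))"

text \<open>
  The type \<open>'o\<close>, together with the embedding \<open>\<iota>\<close> of \<open>K_x\<close>, is a completion \<open>\<Omega>_x\<close> of an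
  algebraic closure of \<open>K_x\<close>: it is a complete field for an absolute value (written
  \<open>dist a 0\<close>) extending that of \<open>K_x\<close>, and it contains a dense copy of the algebraic
  closure, compatibly with \<open>\<iota>\<close>.
\<close>

locale completed_alg_closure =
  fixes \<iota> :: "'a::{field,finite} fls \<Rightarrow> 'o::{field,complete_space}"
  assumes dist_eq: "dist a b = dist (a - b) (0::'o)"
    and abs_mult: "dist (a * b) (0::'o) = dist a 0 * dist b 0"
    and abs_add: "dist (a + b) (0::'o) \<le> max (dist a 0) (dist b 0)"
    and abs_emb: "dist (\<iota> f) 0 = abs_x f"
    and alg_closure_dense: "\<exists>j :: 'a fls alg_closure \<Rightarrow> 'o.
          j 1 = 1 \<and> (\<forall>a b. j (a + b) = j a + j b) \<and> (\<forall>a b. j (a * b) = j a * j b) \<and>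
          (\<forall>f. \<iota> f = j (to_ac f)) \<and> closure (range j) = UNIV"

definition Fq_linear_O :: "('a::{field,finite} fls \<Rightarrow> 'o::field) \<Rightarrow> ('a fps \<Rightarrow> 'o) \<Rightarrow> bool" where
  "Fq_linear_O \<iota> u \<longleftrightarrow>
     Vector_Spaces.linear (\<lambda>c t. fps_const c * t) (\<lambda>c w. \<iota> (fls_const c) * w) u"

definition Fq_linear_K :: "('a::{field,finite} fls \<Rightarrow> 'o::field) \<Rightarrow> ('a fls \<Rightarrow> 'o) \<Rightarrow> bool" where
  "Fq_linear_K \<iota> u \<longleftrightarrow>
     Vector_Spaces.linear (\<lambda>c t. fls_const c * t) (\<lambda>c w. \<iota> (fls_const c) * w) u"

definition Delta_op :: "('a::{field,finite} fls \<Rightarrow> 'o::field) \<Rightarrow> ('a fps \<Rightarrow> 'o) \<Rightarrow> 'a fps \<Rightarrow> 'o" where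
  "Delta_op \<iota> u t = u (fps_X * t) - \<iota> fls_X * u t"

definition d_op :: "('a::{field,finite} fls \<Rightarrow> 'o::field) \<Rightarrow> ('a fps \<Rightarrow> 'o) \<Rightarrow> 'a fps \<Rightarrow> 'o" where
  "d_op \<iota> u t = (THE w. w ^ CARD('a) = Delta_op \<iota> u t)"

definition tau_op :: "('a::{field,finite} fps \<Rightarrow> 'o::field) \<Rightarrow> 'a fps \<Rightarrow> 'o" where
  "tau_op u t = u t ^ CARD('a)"

definition bracket :: "nat \<Rightarrow> 'a::{field,finite} fls" where
  "bracket n = fls_X ^ (CARD('a) ^ n) - fls_X"

text \<open>The sum over \<open>j \<ge> 1\<close> of \<open>t^(q^j) / [j]^n\<close>; the index is shifted by one.\<close>

definition polylog_series ::
    "('a::{field,finite} fls \<Rightarrow> 'o::{field,complete_space}) \<Rightarrow> nat \<Rightarrow> 'a fps \<Rightarrow> 'o" where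
  "polylog_series \<iota> n t =
     (\<Sum>j. \<iota> (fps_to_fls t) ^ (CARD('a) ^ Suc j) / \<iota> (bracket (Suc j)) ^ n)"

definition is_polylog1 ::
    "('a::{field,finite} fls \<Rightarrow> 'o::{field,complete_space}) \<Rightarrow> ('a fps \<Rightarrow> 'o) \<Rightarrow> bool" where
  "is_polylog1 \<iota> u \<longleftrightarrow>
     continuous_on UNIV u \<and> Fq_linear_O \<iota> u \<and>
     (\<forall>t. d_op \<iota> u t - tau_op (d_op \<iota> u) t = \<iota> (fps_to_fls t)) \<and>
     (\<forall>t. abs_x (fps_to_fls t) \<le> 1 / real CARD('a) \<longrightarrow> u t = polylog_series \<iota> 1 t)"

text \<open>
  \<open>polylog \<iota> l1 n\<close> is \<open>l_n\<close> for the chosen solution \<open>l1\<close>. Index 0 is a dummy.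
\<close>

primrec polylog ::
    "('a::{field,finite} fls \<Rightarrow> 'o::{field,complete_space}) \<Rightarrow> ('a fps \<Rightarrow> 'o) \<Rightarrow>
     nat \<Rightarrow> 'a fps \<Rightarrow> 'o" where
  "polylog \<iota> l1 0 = (\<lambda>_. 0)"
| "polylog \<iota> l1 (Suc m) =
     (if m = 0 then l1
      else (THE u. continuous_on UNIV u \<and> Fq_linear_O \<iota> u \<and>
              Delta_op \<iota> u = polylog \<iota> l1 m \<and>
              (\<forall>t. abs_x (fps_to_fls t) \<le> 1 / real CARD('a) \<longrightarrow>
                 u t = polylog_series \<iota> (Suc m) t)))"

text \<open>
  The hyperdifferentiation \<open>D_k\<close>: its values on monomials, extended linearly and
  continuously (the infinite sum is taken in the topology of \<open>O_x\<close>).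
\<close>

definition hyperdiff_monom :: "nat \<Rightarrow> nat \<Rightarrow> 'a::{field,finite} fps" where
  "hyperdiff_monom k n = of_nat (n choose k) * fps_X ^ (n - k)"

definition hyperdiff :: "nat \<Rightarrow> 'a::{field,finite} fps \<Rightarrow> 'a fps" where
  "hyperdiff k \<alpha> = (\<Sum>n. fps_const (fps_nth \<alpha> n) * hyperdiff_monom k n)"

lemma hyperdiff_nth:
  "fps_nth (hyperdiff k \<alpha>) m = of_nat ((m + k) choose k) * fps_nth \<alpha> (m + k)"
proof -
  let ?D = "Abs_fps (\<lambda>m. of_nat ((m + k) choose k) * fps_nth \<alpha> (m + k))"
  have coeff: "fps_nth (fps_const (fps_nth \<alpha> n) * hyperdiff_monom k n) m =
      (if n = m + k then of_nat ((m + k) choose k) * fps_nth \<alpha> (m + k) else 0)" for n m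
  proof (cases "k \<le> n")
    case True
    then show ?thesis
      by (auto simp: hyperdiff_monom_def fps_of_nat[symmetric] mult.commute)
  next
    case False
    then show ?thesis
      by (simp add: hyperdiff_monom_def binomial_eq_0)
  qed
  have "(\<lambda>n. fps_const (fps_nth \<alpha> n) * hyperdiff_monom k n) sums ?D"
    unfolding sums_def
  proof (rule tendsto_fpsI)
    fix m
    show "\<forall>\<^sub>F N in sequentially.
        fps_nth (\<Sum>n<N. fps_const (fps_nth \<alpha> n) * hyperdiff_monom k n) m = fps_nth ?D m"
      using eventually_gt_at_top[of "m + k"]
      by eventually_elim (simp only: fps_sum_nth coeff, simp)
  qed
  then have "hyperdiff k \<alpha> = ?D"
    unfolding hyperdiff_def by (rule sums_unique[symmetric])
  then show ?thesis by simp
qed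

definition fps_hat :: "'a::{field,finite} fps \<Rightarrow> 'a fps" where
  "fps_hat \<alpha> = Abs_fps (\<lambda>n. (-1) ^ n * fps_nth \<alpha> n)"

definition frac_Delta_term ::
    "('a::{field,finite} fls \<Rightarrow> 'o::{field,complete_space}) \<Rightarrow> 'a fps \<Rightarrow> ('a fps \<Rightarrow> 'o) \<Rightarrow>
     'a fps \<Rightarrow> nat \<Rightarrow> 'o" where
  "frac_Delta_term \<iota> \<alpha> u t k =
     (-1) ^ k * \<iota> (fps_to_fls (hyperdiff k (fps_hat \<alpha>))) * u (fps_X ^ k * t)"

definition frac_Delta ::
    "('a::{field,finite} fls \<Rightarrow> 'o::{field,complete_space}) \<Rightarrow> 'a fps \<Rightarrow> ('a fps \<Rightarrow> 'o) \<Rightarrow>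
     'a fps \<Rightarrow> 'o" where
  "frac_Delta \<iota> \<alpha> u t = (\<Sum>k. frac_Delta_term \<iota> \<alpha> u t k)"

text \<open>
  \<open>z\<close> is the value obtained from some representation
  \<open>t = x^(-n) (\<theta>_0 + \<theta>_1 x + \<dots>)\<close> with \<open>n \<ge> 1\<close>.
\<close>

definition zeta_value ::
    "('a::{field,finite} fls \<Rightarrow> 'o::{field,complete_space}) \<Rightarrow> ('a fps \<Rightarrow> 'o) \<Rightarrow>
     'a fls \<Rightarrow> 'o \<Rightarrow> bool" where
  "zeta_value \<iota> l1 t z \<longleftrightarrow>
     (\<exists>n\<ge>1. \<exists>\<theta>. t = fls_X_inv ^ n * fps_to_fls \<theta> \<and> z = frac_Delta \<iota> \<theta> (polylog \<iota> l1 n) 1)"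

definition zeta ::
    "('a::{field,finite} fls \<Rightarrow> 'o::{field,complete_space}) \<Rightarrow> ('a fps \<Rightarrow> 'o) \<Rightarrow>
     'a fls \<Rightarrow> 'o" where
  "zeta \<iota> l1 t = (if t = 0 then 0 else (THE z. zeta_value \<iota> l1 t z))"

end

(* The recursion Delta l_{n+1} = l_n is solved by l_{n+1}(t) = (S(x t) - l_n(t)) / x, where S is the
   defining series on small arguments, so all l_n are continuous and F_q-linear. Formally
   Delta^(alpha) is alpha with x replaced by Delta, and indeed Delta^(x theta) u =
   Delta^(theta) (Delta u) by the Leibniz rule for hyperdifferentiations. Hence
   Delta^(x theta) l_{n+1} = Delta^(theta) l_n, which is the independence of the representation.
   Linearity follows with a common n for both arguments, and continuity at 0 is read off the
   representation with n = 1. *)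
theory Submission
  imports Defs
begin

text \<open>Origin of the hat and the signs: let S send u(t) to u(x t). Multiplying values by x
  commutes with S, and Delta = S - x, so a formal Taylor expansion gives alpha(Delta) = sum_k (D_k
  alpha)(-x) S^k. As \<open>fps_hat\<close> substitutes -x for x, (D_k alpha)(-x) = (-1)^k D_k(hat
  alpha), and the defining series of Delta^(alpha) appears. Linearity of the polylogarithms rests on
  Frobenius: t -> t^(q^j) is additive and fixes F_q. Convergence is cheap because the norm is
  ultrametric, so that terms tending to 0 suffice. Continuity of zeta at 0 needs an estimate of
  Delta^(theta) u uniform in theta: late terms are controlled by u(x^k) -> 0, the finitely many
  early ones because D_k loses at most k factors x. The estimate is for one fixed u, which is why a
  single n has to serve all small t.\<close>

section \<open>Frobenius on F_q and on Laurent series\<close>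

lemma power_CARD_eq_same:
  fixes c :: "'a::{field,finite}"
  shows "c ^ CARD('a) = c"
proof (cases "c = 0")
  case False
  \<comment> \<open>Multiplication by \<open>c\<close> permutes the nonzero elements, so their
    product can be cancelled; the extra factor \<open>c\<close> produces the exponent q
    directly.\<close>
  have "c * (\<Prod>y\<in>UNIV-{0}. c * y) = c * c ^ (CARD('a) - 1) * \<Prod>(UNIV-{0})"
    by (simp add: prod.distrib mult_ac)
  moreover have "(\<Prod>y\<in>UNIV-{0}. c * y) = (\<Prod>y\<in>UNIV-{0}. y)"
    by (rule prod.reindex_bij_witness[of _ "\<lambda>y. y / c" "\<lambda>y. c * y"]) (use False in auto)
  moreover have "c * c ^ (CARD('a) - 1) = c ^ CARD('a)"
    by (metis power_Suc Suc_diff_1 zero_less_card_finite)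
  moreover have "\<Prod>(UNIV - {0::'a}) \<noteq> 0"
    by simp
  ultimately show ?thesis
    by (metis mult_right_cancel)
qed simp

lemma CARD_field_gt_1: "1 < CARD('a::{field,finite})"
proof -
  have "card {0, 1::'a} \<le> CARD('a)"
    by (intro card_mono) auto
  then show ?thesis by simp
qed

lemma CHAR_dvd_CARD_choose:
  assumes "0 < k" "k < CARD('a::{field,finite})"
  shows "CHAR('a) dvd CARD('a) choose k"
proof -
  \<comment> \<open>\<open>(X + 1)^q - X^q - 1\<close> has degree less than \<open>q\<close> but vanishes at all \<open>q\<close> elements.\<close>
  define p :: "'a poly" where
    "p = (\<Sum>i\<in>{0<..<CARD('a)}. Polynomial.monom (of_nat (CARD('a) choose i)) i)"
  have root: "poly p c = 0" for c
  proof -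
    have "(c + 1) ^ CARD('a) = (\<Sum>i\<le>CARD('a). of_nat (CARD('a) choose i) * c ^ i)"
      by (simp add: binomial_ring)
    also have "{..CARD('a)} = insert 0 (insert CARD('a) {0<..<CARD('a)})"
      by auto
    finally have "c + 1 = 1 + (c + poly p c)"
      by (simp add: power_CARD_eq_same p_def poly_sum poly_monom)
    then show ?thesis by simp
  qed
  have "p = 0"
  proof (rule ccontr)
    assume "p \<noteq> 0"
    then have "CARD('a) \<le> Polynomial.degree p"
      using card_poly_roots_bound[of p] root by simp
    moreover have "Polynomial.degree p \<le> CARD('a) - 1"
      unfolding p_def by (intro degree_sum_le) (auto intro: order.trans[OF degree_monom_le])
    ultimately show False
      using CARD_field_gt_1[where 'a='a] by simp
  qed
  then have "of_nat (CARD('a) choose k) = (0::'a)"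
    using assms by (auto simp: p_def poly_eq_iff coeff_sum dest: spec[of _ k])
  then show ?thesis
    by (simp add: of_nat_eq_0_iff_char_dvd)
qed

text \<open>The middle binomial coefficients vanish in characteristic p by the divisibility above,
  so q never has to be written as a power of p.\<close>

lemma fls_power_CARD_add:
  fixes f g :: "'a::{field,finite} fls"
  shows "(f + g) ^ CARD('a) = f ^ CARD('a) + g ^ CARD('a)"
proof -
  have mid: "of_nat (CARD('a) choose i) * f ^ i * g ^ (CARD('a) - i) = 0"
    if "i \<in> {0<..<CARD('a)}" for i
  proof -
    have "CHAR('a fls) dvd CARD('a) choose i"
      using CHAR_dvd_CARD_choose[where 'a='a, of i] that by simp
    then have "(of_nat (CARD('a) choose i) :: 'a fls) = 0"
      using of_nat_eq_0_iff_char_dvd by blast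
    then show ?thesis by simp
  qed
  have "(f + g) ^ CARD('a) =
      (\<Sum>i\<le>CARD('a). of_nat (CARD('a) choose i) * f ^ i * g ^ (CARD('a) - i))"
    by (rule binomial_ring)
  also have "{..CARD('a)} = insert 0 (insert CARD('a) {0<..<CARD('a)})"
    by auto
  also have "(\<Sum>i\<in>insert 0 (insert CARD('a) {0<..<CARD('a)}).
      of_nat (CARD('a) choose i) * f ^ i * g ^ (CARD('a) - i)) = g ^ CARD('a) + f ^ CARD('a)"
    using mid by (simp add: sum.neutral)
  finally show ?thesis by (simp add: add.commute)
qed

lemma fls_power_CARD_power_add:
  fixes f g :: "'a::{field,finite} fls"
  shows "(f + g) ^ (CARD('a) ^ n) = f ^ (CARD('a) ^ n) + g ^ (CARD('a) ^ n)"
  by (induction n) (simp_all add: power_mult fls_power_CARD_add mult.commute[of "CARD('a)"])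

lemma fls_const_power_CARD_power:
  "fls_const c ^ (CARD('a) ^ n) = fls_const (c :: 'a::{field,finite})"
proof (induction n)
  case (Suc n)
  have "fls_const c ^ m = fls_const (c ^ m)" for m
    by (induction m) simp_all
  with Suc show ?case
    by (simp add: power_mult power_CARD_eq_same)
qed simp

section \<open>Representations of Laurent series and the x-adic absolute value\<close>

text \<open>Leading zero digits are allowed, so every sufficiently large \<open>n\<close> works. The
  library gives 0 the subdegree 0, so \<open>t = 0\<close> is covered.\<close>

lemma fls_X_inv_power_decompose:
  fixes t :: "'a::{field,finite} fls"
  assumes "- int n \<le> fls_subdegree t"
  obtains \<theta> where "t = fls_X_inv ^ n * fps_to_fls \<theta>"
proof
  have "fls_subdegree (fls_shift (- int n) t) \<ge> 0"
    using assms by (cases "t = 0") simp_all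
  then have "fps_to_fls (fls_regpart (fls_shift (- int n) t)) = fls_shift (- int n) t"
    by (rule fls_regpart_to_fls_trivial)
  then show "t = fls_X_inv ^ n * fps_to_fls (fls_regpart (fls_shift (- int n) t))"
    by (simp add: fls_X_inv_power_times_conv_shift)
qed

lemma fls_X_inv_power_mult_X_power:
  fixes \<theta> :: "'a::field fps"
  shows "fls_X_inv ^ (n + k) * fps_to_fls (fps_X ^ k * \<theta>) = fls_X_inv ^ n * fps_to_fls \<theta>"
proof -
  have "fls_X_inv * (fls_X :: 'a fls) = 1"
    by (simp add: fls_X_inv_times_conv_shift)
  then have "fls_X_inv ^ k * (fls_X :: 'a fls) ^ k = 1"
    by (metis power_mult_distrib power_one)
  then have "fls_X_inv ^ (n + k) * fls_X ^ k = (fls_X_inv :: 'a fls) ^ n"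
    by (simp add: power_add mult.assoc)
  then show ?thesis
    by (simp only: fls_times_fps_to_fls fps_to_fls_power mult.assoc[symmetric] fps_X_to_fls)
qed

text \<open>The disjunction is there because the library sets
  \<open>subdegree 0 = 0\<close>.\<close>

lemma fps_eq_X_power_mult:
  fixes t :: "'a::field fps"
  assumes "t = 0 \<or> m \<le> subdegree t"
  obtains s where "t = fps_X ^ m * s"
proof
  show "t = fps_X ^ m * fps_shift m t"
    using assms fps_shift_times_fps_X_power[of m t] by (cases "t = 0") (auto simp: mult.commute)
qed

lemma abs_x_fps_to_fls:
  "abs_x (fps_to_fls t) = (if t = 0 then 0 else (1 / real CARD('a)) ^ subdegree t)"
  for t :: "'a::{field,finite} fps"
  by (simp add: abs_x_def fls_subdegree_fls_to_fps power_int_minus power_one_over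
      inverse_eq_divide)

lemma abs_x_fps_X_power_mult_le:
  "abs_x (fps_to_fls (fps_X ^ m * s)) \<le> (1 / real CARD('a)) ^ m"
  for s :: "'a::{field,finite} fps"
  using CARD_field_gt_1[where 'a='a]
  by (auto simp: abs_x_fps_to_fls subdegree_mult intro!: power_decreasing)

lemma abs_x_fps_le_1: "abs_x (fps_to_fls t) \<le> 1" for t :: "'a::{field,finite} fps"
  using abs_x_fps_X_power_mult_le[of 0 t] by simp

text \<open>Translates the disc on which the polylogarithms are prescribed into multiples of x, the
  form in which the series lemmas are stated.\<close>

lemma abs_x_fps_le_iff:
  "abs_x (fps_to_fls t) \<le> 1 / real CARD('a) \<longleftrightarrow> (\<exists>s. t = fps_X * s)"
  for t :: "'a::{field,finite} fps"
proof
  assume le: "abs_x (fps_to_fls t) \<le> 1 / real CARD('a)"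
  have "t = 0 \<or> 1 \<le> subdegree t"
  proof (rule ccontr)
    assume "\<not> ?thesis"
    then have "t \<noteq> 0" "subdegree t = 0"
      by auto
    then show False
      using le CARD_field_gt_1[where 'a='a] by (simp add: abs_x_fps_to_fls)
  qed
  then show "\<exists>s. t = fps_X * s"
    by (metis fps_eq_X_power_mult power_one_right)
next
  assume "\<exists>s. t = fps_X * s"
  then show "abs_x (fps_to_fls t) \<le> 1 / real CARD('a)"
    using abs_x_fps_X_power_mult_le[of 1] by auto
qed

lemma abs_x_fls_X: "abs_x (fls_X :: 'a::{field,finite} fls) = 1 / real CARD('a)"
  by (simp add: abs_x_def inverse_eq_divide power_int_minus)

text \<open>For n >= 1 the exponent q^n exceeds 1, so the lowest term of [n] is -x.\<close>

lemma abs_x_bracket: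
  assumes "1 \<le> n"
  shows "abs_x (bracket n :: 'a::{field,finite} fls) = 1 / real CARD('a)"
proof -
  define N where "N = CARD('a) ^ n"
  have N: "1 < N"
    unfolding N_def using assms CARD_field_gt_1[where 'a='a] by (intro one_less_power) auto
  have "fls_nth (bracket n) 1 = (-1 :: 'a)"
    using N by (simp add: bracket_def N_def[symmetric] del: One_nat_def)
  moreover have "fls_nth (bracket n) k = (0 :: 'a)" if "k < 1" for k
    using N that by (simp add: bracket_def N_def[symmetric] del: One_nat_def)
  ultimately have "fls_subdegree (bracket n :: 'a fls) = 1" "(bracket n :: 'a fls) \<noteq> 0"
    by (auto intro!: fls_subdegree_eqI)
  then show ?thesis
    by (simp add: abs_x_def inverse_eq_divide power_int_minus)
qed

section \<open>Algebra of the hat and of the hyperdifferentiations\<close>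

lemma fps_hat_add: "fps_hat (f + g) = fps_hat f + fps_hat g"
  by (simp add: fps_hat_def fps_eq_iff algebra_simps)

lemma fps_hat_const_mult: "fps_hat (fps_const c * f) = fps_const c * fps_hat f"
  by (simp add: fps_hat_def fps_eq_iff algebra_simps)

lemma fps_hat_X_mult: "fps_hat (fps_X * f) = - (fps_X * fps_hat f)"
proof (rule fps_ext)
  fix n show "fps_nth (fps_hat (fps_X * f)) n = fps_nth (- (fps_X * fps_hat f)) n"
    by (cases n) (simp_all add: fps_hat_def)
qed

lemma fps_hat_X_power_mult:
  "fps_hat (fps_X ^ m * f) = fps_X ^ m * (fps_const ((-1) ^ m) * fps_hat f)"
  by (induction m)
    (simp_all add: fps_hat_X_mult mult.assoc fps_const_neg[symmetric] del: fps_const_neg)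

lemma fps_hat_one: "fps_hat 1 = 1"
  by (auto simp: fps_hat_def fps_eq_iff)

lemma hyperdiff_add: "hyperdiff k (f + g) = hyperdiff k f + hyperdiff k g"
  by (simp add: fps_eq_iff hyperdiff_nth algebra_simps)

lemma hyperdiff_const_mult: "hyperdiff k (fps_const c * f) = fps_const c * hyperdiff k f"
  by (simp add: fps_eq_iff hyperdiff_nth algebra_simps)

lemma hyperdiff_minus: "hyperdiff k (- f) = - hyperdiff k f"
  by (simp add: fps_eq_iff hyperdiff_nth algebra_simps)

lemma hyperdiff_0: "hyperdiff 0 f = f"
  by (simp add: fps_eq_iff hyperdiff_nth)

lemma hyperdiff_one: "hyperdiff k 1 = (if k = 0 then 1 else 0)"
  by (auto simp: fps_eq_iff hyperdiff_nth)

text \<open>Pascal's rule, read coefficientwise.\<close>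

lemma hyperdiff_Suc_X_mult:
  "hyperdiff (Suc k) (fps_X * f) = fps_X * hyperdiff (Suc k) f + hyperdiff k f"
proof (rule fps_ext)
  fix m
  show "fps_nth (hyperdiff (Suc k) (fps_X * f)) m =
      fps_nth (fps_X * hyperdiff (Suc k) f + hyperdiff k f) m"
    by (cases m) (simp_all add: hyperdiff_nth algebra_simps)
qed

text \<open>D_k lowers the order of vanishing by at most \<open>k\<close>; this bounds the early
  terms in \<open>frac_Delta_small\<close>.\<close>

lemma hyperdiff_X_power_mult:
  "\<exists>g. hyperdiff k (fps_X ^ (m + k) * f) = fps_X ^ m * g"
proof -
  have "fps_nth (hyperdiff k (fps_X ^ (m + k) * f)) i = 0" if "i < m" for i
    using that by (simp add: hyperdiff_nth fps_X_power_mult_nth)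
  then have "hyperdiff k (fps_X ^ (m + k) * f) = 0 \<or>
      m \<le> subdegree (hyperdiff k (fps_X ^ (m + k) * f))"
    using subdegree_geI by blast
  then show ?thesis
    by (metis fps_eq_X_power_mult)
qed

section \<open>Ultrametric limits and series in Omega_x\<close>

context completed_alg_closure
begin

abbreviation nrm :: "'o \<Rightarrow> real" where "nrm a \<equiv> dist a 0"

text \<open>The homomorphism laws of \<open>\<iota>\<close> come from its factorization through the
  algebraic closure.\<close>

lemma emb_hom:
  "\<iota> (f + g) = \<iota> f + \<iota> g" "\<iota> (f * g) = \<iota> f * \<iota> g" "\<iota> 1 = 1" "\<iota> 0 = 0"
  "\<iota> (- f) = - \<iota> f" "\<iota> (f - g) = \<iota> f - \<iota> g" "\<iota> (f ^ n) = \<iota> f ^ n"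
proof -
  obtain j :: "'a fls alg_closure \<Rightarrow> 'o"
    where j: "j 1 = 1" "\<And>a b. j (a + b) = j a + j b" "\<And>a b. j (a * b) = j a * j b"
      "\<And>f. \<iota> f = j (to_ac f)"
    using alg_closure_dense by blast
  show add: "\<iota> (f + g) = \<iota> f + \<iota> g" for f g
    by (simp add: j)
  show mult: "\<iota> (f * g) = \<iota> f * \<iota> g" for f g
    by (simp add: j)
  show one: "\<iota> 1 = 1"
    by (simp add: j)
  show zero: "\<iota> 0 = 0"
    using add[of 0 0] by (metis add.right_neutral add_left_cancel)
  show uminus: "\<iota> (- f) = - \<iota> f" for f
    using add[of f "- f"] zero by (simp add: eq_neg_iff_add_eq_0 add.commute)
  show "\<iota> (f - g) = \<iota> f - \<iota> g"
    using add[of f "- g"] uminus by simp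
  show "\<iota> (f ^ n) = \<iota> f ^ n"
    by (induction n) (simp_all add: one mult)
qed

lemma nrm_minus: "nrm (- a) = nrm a"
  by (metis dist_commute dist_eq diff_0 diff_zero)

lemma nrm_diff: "nrm (a - b) \<le> max (nrm a) (nrm b)"
  using abs_add[of a "- b"] by (simp add: nrm_minus)

lemma nrm_one: "nrm 1 = 1"
  using abs_mult[of 1 1] by simp

lemma nrm_power: "nrm (a ^ n) = nrm a ^ n"
  by (induction n) (simp_all add: nrm_one abs_mult)

lemma nrm_divide: "nrm (a / b) = nrm a / nrm b"
proof (cases "b = 0")
  case False
  then have "nrm (a / b) * nrm b = nrm a"
    by (simp add: abs_mult[symmetric])
  with False show ?thesis
    by (simp add: field_simps)
qed simp

lemma nrm_sum_le:
  assumes "\<And>i. i \<in> A \<Longrightarrow> nrm (f i) \<le> B" "0 \<le> B"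
  shows "nrm (sum f A) \<le> B"
  using assms
proof (induction A rule: infinite_finite_induct)
  case (insert x F)
  have "nrm (f x) \<le> B" "nrm (sum f F) \<le> B"
    using insert.IH insert.prems by simp_all
  then have "max (nrm (f x)) (nrm (sum f F)) \<le> B"
    by (rule max.boundedI)
  with abs_add[of "f x" "sum f F"] have "nrm (f x + sum f F) \<le> B"
    by (rule order.trans)
  then show ?case
    by (simp only: sum.insert[OF insert.hyps] not_False_eq_True)
next
  case (infinite A)
  then show ?case by (simp only: sum.infinite dist_self not_False_eq_True)
next
  case empty
  then show ?case by (simp only: sum.empty dist_self)
qed

text \<open>Metric and field operations of \<open>'o\<close> are tied together only by the locale
  axioms, so the limit rules are derived from the ultrametric inequality.\<close>

lemma tendsto_add_nrm:
  assumes "(f \<longlongrightarrow> a) F" "(g \<longlongrightarrow> b) F"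
  shows "((\<lambda>x. f x + g x :: 'o) \<longlongrightarrow> a + b) F"
proof -
  have "((\<lambda>x. nrm (f x - a) + nrm (g x - b)) \<longlongrightarrow> 0 + 0) F"
    using assms[THEN iffD1[OF tendsto_dist_iff]]
    by (intro tendsto_add) (simp_all only: dist_eq[of _ a] dist_eq[of _ b])
  then have lim: "((\<lambda>x. nrm (f x - a) + nrm (g x - b)) \<longlongrightarrow> 0) F"
    by simp
  have le: "dist (f x + g x) (a + b) \<le> dist (nrm (f x - a) + nrm (g x - b)) 0" for x
  proof -
    have "dist (f x + g x) (a + b) = nrm ((f x - a) + (g x - b))"
      by (simp only: dist_eq[of "f x + g x"] add_diff_add)
    also note abs_add
    also have "max (nrm (f x - a)) (nrm (g x - b)) \<le> nrm (f x - a) + nrm (g x - b)"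
      by (intro max.boundedI) (simp_all only: le_add_same_cancel1 le_add_same_cancel2 zero_le_dist)
    also have "\<dots> = dist (nrm (f x - a) + nrm (g x - b)) 0"
      by (simp add: dist_real_def)
    finally show ?thesis .
  qed
  from lim show ?thesis
    by (rule metric_tendsto_imp_tendsto) (intro always_eventually allI le)
qed

lemma tendsto_mult_left_nrm:
  assumes "(f \<longlongrightarrow> a) F"
  shows "((\<lambda>x. c * f x :: 'o) \<longlongrightarrow> c * a) F"
proof -
  have "((\<lambda>x. nrm c * dist (f x) a) \<longlongrightarrow> nrm c * 0) F"
    by (intro tendsto_mult tendsto_const iffD1[OF tendsto_dist_iff assms])
  moreover have "dist (c * f x) (c * a) = nrm c * dist (f x) a" for x
    by (simp add: dist_eq[of "c * f x"] dist_eq[of "f x"] abs_mult[symmetric] right_diff_distrib)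
  ultimately show ?thesis
    by (subst tendsto_dist_iff) simp
qed

lemma sums_add_nrm:
  assumes "f sums a" "g sums (b :: 'o)"
  shows "(\<lambda>n. f n + g n) sums (a + b)"
  using tendsto_add_nrm[OF assms[unfolded sums_def]] by (simp add: sums_def sum.distrib)

lemma sums_mult_nrm:
  assumes "f sums (a :: 'o)"
  shows "(\<lambda>n. c * f n) sums (c * a)"
  using tendsto_mult_left_nrm[OF assms[unfolded sums_def]] by (simp add: sums_def sum_distrib_left)

text \<open>A block of consecutive terms is no larger than its largest term, so the partial sums are
  Cauchy as soon as the terms tend to 0.\<close>

lemma summable_nrm:
  fixes f :: "nat \<Rightarrow> 'o"
  assumes "f \<longlonglongrightarrow> 0"
  shows "summable f"
proof -
  have "Cauchy (\<lambda>n. sum f {..<n})"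
    unfolding Cauchy_altdef
  proof (intro allI impI)
    fix e :: real assume e: "0 < e"
    then obtain N where N: "\<And>n. N \<le> n \<Longrightarrow> nrm (f n) < e / 2"
      using assms unfolding lim_sequentially by (metis half_gt_zero)
    have "dist (sum f {..<m}) (sum f {..<n}) < e" if "N \<le> m" "m < n" for m n
    proof -
      have "sum f {..<n} - sum f {..<m} = sum f {m..<n}"
        using that by (simp add: lessThan_atLeast0 sum_diff_nat_ivl)
      moreover have "nrm (sum f {m..<n}) \<le> e / 2"
        using that e by (intro nrm_sum_le less_imp_le[OF N]) auto
      ultimately show ?thesis
        using e by (simp add: dist_commute[of "sum f {..<m}"] dist_eq[of "sum f {..<n}"])
    qed
    then show "\<exists>M. \<forall>m\<ge>M. \<forall>n>m. dist (sum f {..<m}) (sum f {..<n}) < e"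
      by blast
  qed
  then show ?thesis
    by (simp add: Cauchy_convergent_iff convergent_def summable_def sums_def)
qed

lemma nrm_sums_le:
  assumes "f sums s" "\<And>i. nrm (f i) \<le> B"
  shows "nrm s \<le> B"
proof -
  have "0 \<le> B"
    using assms(2)[of 0] zero_le_dist order.trans by blast
  then have "nrm (sum f {..<n}) \<le> B" for n
    using assms(2) by (intro nrm_sum_le)
  moreover have "(\<lambda>n. nrm (sum f {..<n})) \<longlonglongrightarrow> nrm s"
    using assms(1) unfolding sums_def by (intro tendsto_dist) auto
  ultimately show ?thesis
    by (intro LIMSEQ_le_const2) auto
qed

section \<open>Linearity, and continuity of additive maps\<close>

text \<open>\<open>Vector_Spaces.linear\<close> also contains the vector space laws of both
  scalings; they hold here, which leaves the two identities.\<close>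

lemma Fq_linear_O_iff:
  "Fq_linear_O \<iota> u \<longleftrightarrow> (\<forall>s t. u (s + t) = u s + u t) \<and>
     (\<forall>c t. u (fps_const c * t) = \<iota> (fls_const c) * u t)"
proof -
  have "vector_space (\<lambda>c t. fps_const c * t :: 'a fps)"
    by unfold_locales (simp_all add: algebra_simps fps_const_add[symmetric] del: fps_const_add)
  moreover have "vector_space (\<lambda>c w. \<iota> (fls_const c) * w)"
    by unfold_locales
      (simp_all add: algebra_simps fls_plus_const[symmetric] fls_const_mult_const[symmetric] emb_hom
        del: fls_plus_const fls_const_mult_const)
  ultimately show ?thesis
    by (simp add: Fq_linear_O_def Vector_Spaces.linear_iff)
qed

lemma Fq_linear_K_iff:
  "Fq_linear_K \<iota> u \<longleftrightarrow> (\<forall>s t. u (s + t) = u s + u t) \<and>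
     (\<forall>c t. u (fls_const c * t) = \<iota> (fls_const c) * u t)"
proof -
  have "vector_space (\<lambda>c t. fls_const c * t :: 'a fls)"
    by unfold_locales
      (simp_all add: algebra_simps fls_plus_const[symmetric] fls_const_mult_const[symmetric]
        del: fls_plus_const fls_const_mult_const)
  moreover have "vector_space (\<lambda>c w. \<iota> (fls_const c) * w)"
    by unfold_locales
      (simp_all add: algebra_simps fls_plus_const[symmetric] fls_const_mult_const[symmetric] emb_hom
        del: fls_plus_const fls_const_mult_const)
  ultimately show ?thesis
    by (simp add: Fq_linear_K_def Vector_Spaces.linear_iff)
qed

text \<open>Additivity transports smallness near 0 to every point, and the ideals x^M O_x are a
  neighbourhood base of 0.\<close>

lemma continuous_on_additive_fps:
  assumes add: "\<And>s t. u (s + t) = u s + u t"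
    and small: "\<And>e. 0 < e \<Longrightarrow> \<exists>M. \<forall>s. nrm (u (fps_X ^ M * s)) < e"
  shows "continuous_on UNIV (u :: 'a fps \<Rightarrow> 'o)"
  unfolding continuous_on_iff
proof (intro ballI allI impI)
  fix t :: "'a fps" and e :: real
  assume "0 < e"
  then obtain M where M: "\<And>s. nrm (u (fps_X ^ M * s)) < e"
    using small by blast
  show "\<exists>d>0. \<forall>t'\<in>UNIV. dist t' t < d \<longrightarrow> dist (u t') (u t) < e"
  proof (intro exI conjI ballI impI)
    \<comment> \<open>Distinct power series have library distance 2^(-d), with d the subdegree of
      their difference, so this radius forces \<open>M\<close> factors x.\<close>
    show "(0::real) < inverse (2 ^ M)"
      by simp
    fix t' :: "'a fps"
    assume "dist t' t < inverse (2 ^ M)"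
    then have "t' - t = 0 \<or> M \<le> subdegree (t' - t)"
      by (auto simp: dist_fps_def split: if_splits)
    then obtain s where "t' - t = fps_X ^ M * s"
      by (rule fps_eq_X_power_mult)
    moreover have "u t' - u t = u (t' - t)"
      using add[of t "t' - t"] by simp
    ultimately show "dist (u t') (u t) < e"
      using M by (simp add: dist_eq[of "u t'"])
  qed
qed

lemma continuous_on_fps_small:
  assumes "continuous_on UNIV (u :: 'a fps \<Rightarrow> 'o)" "u 0 = 0" "0 < e"
  shows "\<exists>M. \<forall>s. nrm (u (fps_X ^ M * s)) < e"
proof -
  obtain d where d: "0 < d" "\<And>t. dist t 0 < d \<Longrightarrow> nrm (u t) < e"
    using assms unfolding continuous_on_iff by (metis UNIV_I)
  obtain M where M: "(1 / 2 :: real) ^ M < d"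
    using real_arch_pow_inv[OF d(1), of "1 / 2"] by auto
  have "dist (fps_X ^ M * s) 0 \<le> (1 / 2) ^ M" for s :: "'a fps"
  proof (cases "s = 0")
    case False
    then have "dist (fps_X ^ M * s) 0 = (1 / 2) ^ (M + subdegree s)"
      by (simp add: dist_fps_def power_one_over inverse_eq_divide)
    also have "\<dots> \<le> (1 / 2) ^ M"
      by (intro power_decreasing) auto
    finally show ?thesis .
  qed simp
  then show ?thesis
    using M d(2) order.strict_trans1 by blast
qed

lemma Fq_linear_O_0: "Fq_linear_O \<iota> u \<Longrightarrow> u 0 = 0"
  unfolding Fq_linear_O_iff by (metis add_0 add_cancel_right_right)

section \<open>The polylogarithm series on the disc x O_x\<close>

definition polylog_term :: "nat \<Rightarrow> 'a fps \<Rightarrow> nat \<Rightarrow> 'o" where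
  "polylog_term n t j =
     \<iota> (fps_to_fls t) ^ (CARD('a) ^ Suc j) / \<iota> (bracket (Suc j)) ^ n"

lemma polylog_series_eq: "polylog_series \<iota> n t = suminf (polylog_term n t)"
  by (simp add: polylog_series_def polylog_term_def[abs_def])

text \<open>The bound is deliberately weak: it decays geometrically both in \<open>j\<close>, for
  convergence, and in \<open>m\<close>, for continuity. The factor q^n comes from |[j]| =
  1/q.\<close>

lemma nrm_polylog_term_le:
  "nrm (polylog_term n (fps_X ^ Suc m * s) j)
     \<le> (1 / real CARD('a)) ^ (m + Suc j) * real CARD('a) ^ n"
proof -
  define Q where "Q = CARD('a) ^ Suc j"
  have q: "1 < CARD('a)"
    by (rule CARD_field_gt_1)
  then have "Suc j < Q"
    unfolding Q_def using power_gt_expt[of "CARD('a)" "Suc j"] by simp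
  \<comment> \<open>Split \<open>Suc m * Q\<close> as \<open>Q + m * Q\<close>; the first part
    exceeds \<open>Suc j\<close>, the second is at least \<open>m\<close>.\<close>
  moreover have "m * 1 \<le> m * Q"
    using \<open>Suc j < Q\<close> by (intro mult_le_mono2) linarith
  ultimately have exp: "m + Suc j \<le> Suc m * Q"
    unfolding mult_Suc by linarith
  have "abs_x (fps_to_fls (fps_X ^ Suc m * s)) ^ Q \<le> ((1 / real CARD('a)) ^ Suc m) ^ Q"
    by (intro power_mono abs_x_fps_X_power_mult_le) (simp add: abs_x_def)
  also have "\<dots> = (1 / real CARD('a)) ^ (Suc m * Q)"
    by (rule power_mult[symmetric])
  also have "\<dots> \<le> (1 / real CARD('a)) ^ (m + Suc j)"
    using q exp by (intro power_decreasing) auto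
  finally have "abs_x (fps_to_fls (fps_X ^ Suc m * s)) ^ Q * real CARD('a) ^ n
      \<le> (1 / real CARD('a)) ^ (m + Suc j) * real CARD('a) ^ n"
    by (rule mult_right_mono) simp
  moreover have "nrm (polylog_term n (fps_X ^ Suc m * s) j)
      = abs_x (fps_to_fls (fps_X ^ Suc m * s)) ^ Q * real CARD('a) ^ n"
    unfolding polylog_term_def Q_def[symmetric]
    by (simp only: nrm_divide nrm_power abs_emb abs_x_bracket[of "Suc j"] le_add1 plus_1_eq_Suc)
      (simp add: abs_x_bracket power_one_over)
  ultimately show ?thesis
    by simp
qed

lemma polylog_term_sums:
  "polylog_term n (fps_X * s) sums polylog_series \<iota> n (fps_X * s)"
proof -
  have q: "1 < real CARD('a)"
    using CARD_field_gt_1[where 'a='a] by simp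
  have "(\<lambda>j. (1 / real CARD('a)) ^ Suc j * real CARD('a) ^ n) \<longlonglongrightarrow> 0 * real CARD('a) ^ n"
    using q by (intro tendsto_mult_right LIMSEQ_Suc LIMSEQ_realpow_zero) auto
  then have lim: "(\<lambda>j. (1 / real CARD('a)) ^ Suc j * real CARD('a) ^ n) \<longlonglongrightarrow> 0"
    by simp
  have "nrm (polylog_term n (fps_X * s) j)
      \<le> dist ((1 / real CARD('a)) ^ Suc j * real CARD('a) ^ n) 0" for j
    using nrm_polylog_term_le[of n 0 s j] by (simp add: dist_real_def)
  then have "polylog_term n (fps_X * s) \<longlonglongrightarrow> 0"
    by (intro metric_tendsto_imp_tendsto[OF lim] always_eventually allI)
  then show ?thesis
    unfolding polylog_series_eq by (rule summable_sums[OF summable_nrm])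
qed

lemma nrm_polylog_series_le:
  "nrm (polylog_series \<iota> n (fps_X ^ Suc m * s)) \<le> (1 / real CARD('a)) ^ m * real CARD('a) ^ n"
proof (rule nrm_sums_le)
  show "polylog_term n (fps_X ^ Suc m * s) sums polylog_series \<iota> n (fps_X ^ Suc m * s)"
    using polylog_term_sums[of n "fps_X ^ m * s"] by (simp add: mult.assoc)
  fix j
  have "(1 / real CARD('a)) ^ (m + Suc j) \<le> (1 / real CARD('a)) ^ m"
    using CARD_field_gt_1[where 'a='a] by (intro power_decreasing) auto
  then have "(1 / real CARD('a)) ^ (m + Suc j) * real CARD('a) ^ n
      \<le> (1 / real CARD('a)) ^ m * real CARD('a) ^ n"
    by (rule mult_right_mono) simp
  with nrm_polylog_term_le show "nrm (polylog_term n (fps_X ^ Suc m * s) j)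
      \<le> (1 / real CARD('a)) ^ m * real CARD('a) ^ n"
    by (rule order.trans)
qed

text \<open>Holds termwise: the powers are pulled back through \<open>\<iota>\<close> to
  \<open>'a fls\<close>, where Frobenius is known to be additive. The factor \<open>fps_X\<close>
  keeps the arguments in the disc of convergence.\<close>

lemma polylog_series_add:
  "polylog_series \<iota> n (fps_X * (s + t)) =
     polylog_series \<iota> n (fps_X * s) + polylog_series \<iota> n (fps_X * t)"
proof -
  have "polylog_term n (fps_X * (s + t)) j = polylog_term n (fps_X * s) j + polylog_term n (fps_X * t) j"
    for j
    unfolding polylog_term_def
    by (simp only: emb_hom(7)[symmetric] distrib_left fps_to_fls_plus fls_power_CARD_power_add)
      (simp only: emb_hom add_divide_distrib)
  then have "polylog_term n (fps_X * (s + t)) =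
      (\<lambda>j. polylog_term n (fps_X * s) j + polylog_term n (fps_X * t) j)"
    by (rule ext)
  moreover have "(\<lambda>j. polylog_term n (fps_X * s) j + polylog_term n (fps_X * t) j) sums
      (polylog_series \<iota> n (fps_X * s) + polylog_series \<iota> n (fps_X * t))"
    by (intro sums_add_nrm polylog_term_sums)
  ultimately show ?thesis
    unfolding polylog_series_eq[of n "fps_X * (s + t)"] by (simp add: sums_unique[symmetric])
qed

lemma polylog_series_scale:
  "polylog_series \<iota> n (fps_X * (fps_const c * s)) =
     \<iota> (fls_const c) * polylog_series \<iota> n (fps_X * s)"
proof -
  have "fps_to_fls (fps_X * (fps_const c * s)) = fls_const c * fps_to_fls (fps_X * s)"
    by (simp add: fls_times_fps_to_fls mult.left_commute)
  then have "polylog_term n (fps_X * (fps_const c * s)) j =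
      \<iota> (fls_const c) * polylog_term n (fps_X * s) j" for j
    unfolding polylog_term_def
    by (simp only: emb_hom(7)[symmetric] power_mult_distrib fls_const_power_CARD_power)
      (simp only: emb_hom times_divide_eq_right)
  then have "polylog_term n (fps_X * (fps_const c * s)) =
      (\<lambda>j. \<iota> (fls_const c) * polylog_term n (fps_X * s) j)"
    by (rule ext)
  moreover have "(\<lambda>j. \<iota> (fls_const c) * polylog_term n (fps_X * s) j) sums
      (\<iota> (fls_const c) * polylog_series \<iota> n (fps_X * s))"
    by (intro sums_mult_nrm polylog_term_sums)
  ultimately show ?thesis
    unfolding polylog_series_eq[of n "fps_X * (fps_const c * s)"]
    by (simp add: sums_unique[symmetric])
qed

lemma emb_bracket_nonzero: "\<iota> (bracket (Suc j)) \<noteq> 0"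
  using abs_emb[of "bracket (Suc j)"] abs_x_bracket[of "Suc j", where 'a='a] by auto

text \<open>Since \<open>x^(q^j) = [j] + x\<close>, the series solve \<open>\<Delta> l_{n+1} = l_n\<close> termwise.\<close>

lemma polylog_series_Delta:
  "polylog_series \<iota> (Suc n) (fps_X * (fps_X * s)) =
     polylog_series \<iota> n (fps_X * s) + \<iota> fls_X * polylog_series \<iota> (Suc n) (fps_X * s)"
proof -
  have "polylog_term (Suc n) (fps_X * (fps_X * s)) j =
      polylog_term n (fps_X * s) j + \<iota> fls_X * polylog_term (Suc n) (fps_X * s) j" for j
  proof -
    define y where "y = \<iota> (fps_to_fls (fps_X * s)) ^ (CARD('a) ^ Suc j)"
    define b where "b = \<iota> (bracket (Suc j))"
    have b: "b \<noteq> 0"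
      unfolding b_def by (rule emb_bracket_nonzero)
    have "\<iota> fls_X ^ (CARD('a) ^ Suc j) = b + \<iota> fls_X"
      unfolding b_def bracket_def by (simp only: emb_hom diff_add_cancel)
    then have "\<iota> (fps_to_fls (fps_X * (fps_X * s))) ^ (CARD('a) ^ Suc j) = (b + \<iota> fls_X) * y"
      unfolding y_def fls_times_fps_to_fls[of fps_X "fps_X * s"] fps_X_to_fls emb_hom
      by (simp only: power_mult_distrib)
    then show ?thesis
      using b unfolding polylog_term_def y_def[symmetric] b_def[symmetric]
      by (simp add: field_simps)
  qed
  then have "polylog_term (Suc n) (fps_X * (fps_X * s)) =
      (\<lambda>j. polylog_term n (fps_X * s) j + \<iota> fls_X * polylog_term (Suc n) (fps_X * s) j)"
    by (rule ext)
  moreover have "(\<lambda>j. polylog_term n (fps_X * s) j + \<iota> fls_X * polylog_term (Suc n) (fps_X * s) j) sums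
      (polylog_series \<iota> n (fps_X * s) + \<iota> fls_X * polylog_series \<iota> (Suc n) (fps_X * s))"
    by (intro sums_add_nrm sums_mult_nrm polylog_term_sums)
  ultimately show ?thesis
    unfolding polylog_series_eq[of "Suc n" "fps_X * (fps_X * s)"] by (simp add: sums_unique[symmetric])
qed

lemma emb_X_nonzero: "\<iota> fls_X \<noteq> 0"
  using abs_emb[of fls_X] abs_x_fls_X[where 'a='a] by auto

section \<open>Solving the recursion for the polylogarithms\<close>

text \<open>Multiplication by x maps all of O_x into the disc where the values are prescribed, so
  the equation at t determines u(t).\<close>

lemma polylog_recursion_unique:
  assumes cont: "continuous_on UNIV v" and lin: "Fq_linear_O \<iota> v"
    and series: "\<And>s. v (fps_X * s) = polylog_series \<iota> n (fps_X * s)"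
  shows "\<exists>!u. continuous_on UNIV u \<and> Fq_linear_O \<iota> u \<and> Delta_op \<iota> u = v \<and>
    (\<forall>t. abs_x (fps_to_fls t) \<le> 1 / real CARD('a) \<longrightarrow> u t = polylog_series \<iota> (Suc n) t)"
proof -
  define u where "u t = (polylog_series \<iota> (Suc n) (fps_X * t) - v t) / \<iota> fls_X" for t
  have linv: "v (s + t) = v s + v t" "v (fps_const c * t) = \<iota> (fls_const c) * v t" for s t c
    using lin by (auto simp: Fq_linear_O_iff)
  have add: "u (s + t) = u s + u t" for s t
    unfolding u_def polylog_series_add linv
    by (simp only: add_divide_distrib[symmetric] add_diff_add)
  have scale: "u (fps_const c * t) = \<iota> (fls_const c) * u t" for c t
    unfolding u_def polylog_series_scale linv
    by (simp only: right_diff_distrib[symmetric] times_divide_eq_right)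
  \<comment> \<open>Consistency on the disc: the formula for \<open>u\<close> returns the prescribed
    series because \<open>v\<close> is given by the preceding series there.\<close>
  have ser: "u (fps_X * s) = polylog_series \<iota> (Suc n) (fps_X * s)" for s
    unfolding u_def polylog_series_Delta series using emb_X_nonzero by simp
  have Del: "Delta_op \<iota> u = v"
    unfolding Delta_op_def ser using emb_X_nonzero by (simp add: u_def fun_eq_iff)
  have small: "\<exists>M. \<forall>s. nrm (u (fps_X ^ M * s)) < e" if "0 < e" for e
  proof -
    have q: "1 < real CARD('a)"
      using CARD_field_gt_1[where 'a='a] by simp
    \<comment> \<open>Dividing by x multiplies the norm by q, hence \<open>e / CARD('a)\<close>; the
      power q^(n+1) offsets the factor in \<open>nrm_polylog_series_le\<close>.\<close>
    have pos: "0 < e / CARD('a)" "0 < e / CARD('a) / real CARD('a) ^ Suc n"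
      using that q by simp_all
    obtain M1 where M1: "\<And>s. nrm (v (fps_X ^ M1 * s)) < e / CARD('a)"
      using continuous_on_fps_small[OF cont Fq_linear_O_0[OF lin] pos(1)] by blast
    obtain M2 where M2: "(1 / real CARD('a)) ^ M2 < e / CARD('a) / real CARD('a) ^ Suc n"
      using real_arch_pow_inv[OF pos(2), of "1 / real CARD('a)"] q
      by (meson divide_less_eq_1_pos order.strict_trans zero_less_one)
    have M2': "nrm (polylog_series \<iota> (Suc n) (fps_X * (fps_X ^ M2 * s))) < e / CARD('a)" for s
    proof -
      have "(1 / real CARD('a)) ^ M2 * real CARD('a) ^ Suc n < e / CARD('a)"
        using M2 q by (subst (asm) pos_less_divide_eq) simp_all
      with nrm_polylog_series_le[of "Suc n" M2 s] show ?thesis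
        by (simp add: mult.assoc)
    qed
    show ?thesis
    proof (intro exI allI)
      fix s :: "'a fps"
      \<comment> \<open>With exponent \<open>M1 + M2\<close>, \<open>t\<close> is a multiple of both
        x^M1 and x^M2.\<close>
      define t where "t = fps_X ^ (M1 + M2) * s"
      have "t = fps_X ^ M1 * (fps_X ^ M2 * s)" "t = fps_X ^ M2 * (fps_X ^ M1 * s)"
        by (simp_all add: t_def power_add mult_ac)
      then have "nrm (v t) < e / CARD('a)" "nrm (polylog_series \<iota> (Suc n) (fps_X * t)) < e / CARD('a)"
        using M1 M2' by metis+
      then have "nrm (polylog_series \<iota> (Suc n) (fps_X * t) - v t) < e / CARD('a)"
        using nrm_diff[of "polylog_series \<iota> (Suc n) (fps_X * t)" "v t"]
        by (metis max_less_iff_conj order.strict_trans1)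
      then have "nrm (polylog_series \<iota> (Suc n) (fps_X * t) - v t) * CARD('a) < e"
        using q by (simp add: pos_less_divide_eq)
      then show "nrm (u t) < e"
        unfolding u_def nrm_divide abs_emb abs_x_fls_X by simp
    qed
  qed
  show ?thesis
  proof (rule ex1I[of _ u], intro conjI)
    show "continuous_on UNIV u"
      using add small by (rule continuous_on_additive_fps)
    show "Fq_linear_O \<iota> u"
      unfolding Fq_linear_O_iff using add scale by blast
    show "Delta_op \<iota> u = v"
      by (rule Del)
    show "\<forall>t. abs_x (fps_to_fls t) \<le> 1 / real CARD('a) \<longrightarrow> u t = polylog_series \<iota> (Suc n) t"
      using ser by (auto simp: abs_x_fps_le_iff)
  next
    fix w
    assume w: "continuous_on UNIV w \<and> Fq_linear_O \<iota> w \<and> Delta_op \<iota> w = v \<and>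
      (\<forall>t. abs_x (fps_to_fls t) \<le> 1 / real CARD('a) \<longrightarrow> w t = polylog_series \<iota> (Suc n) t)"
    show "w = u"
    proof (rule ext)
      fix t
      have "w (fps_X * t) = polylog_series \<iota> (Suc n) (fps_X * t)"
        using w abs_x_fps_le_iff[of "fps_X * t"] by blast
      moreover have "v t = w (fps_X * t) - \<iota> fls_X * w t"
        using w by (auto simp: Delta_op_def)
      ultimately show "w t = u t"
        unfolding u_def using emb_X_nonzero by simp
    qed
  qed
qed

text \<open>Agreement with the series is carried along because the next recursion step requires it.
  The guard \<open>n \<noteq> 0\<close> excludes the dummy index 0.\<close>

lemma polylog_Suc_props:
  assumes "is_polylog1 \<iota> l1"
  shows "continuous_on UNIV (polylog \<iota> l1 (Suc n)) \<and> Fq_linear_O \<iota> (polylog \<iota> l1 (Suc n)) \<and>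
    (n \<noteq> 0 \<longrightarrow> Delta_op \<iota> (polylog \<iota> l1 (Suc n)) = polylog \<iota> l1 n) \<and>
    (\<forall>t. abs_x (fps_to_fls t) \<le> 1 / real CARD('a) \<longrightarrow>
       polylog \<iota> l1 (Suc n) t = polylog_series \<iota> (Suc n) t)"
proof (induction n)
  case 0
  then show ?case
    using assms by (simp add: is_polylog1_def)
next
  case (Suc n)
  let ?P = "\<lambda>u. continuous_on UNIV u \<and> Fq_linear_O \<iota> u \<and> Delta_op \<iota> u = polylog \<iota> l1 (Suc n) \<and>
    (\<forall>t. abs_x (fps_to_fls t) \<le> 1 / real CARD('a) \<longrightarrow> u t = polylog_series \<iota> (Suc (Suc n)) t)"
  have "\<exists>!u. ?P u"
  proof (rule polylog_recursion_unique)
    fix s :: "'a fps"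
    show "polylog \<iota> l1 (Suc n) (fps_X * s) = polylog_series \<iota> (Suc n) (fps_X * s)"
      using Suc abs_x_fps_le_iff[of "fps_X * s"] by blast
  qed (use Suc in blast)+
  then have "?P (THE u. ?P u)"
    by (rule theI')
  moreover have "polylog \<iota> l1 (Suc (Suc n)) = (THE u. ?P u)"
    by simp
  ultimately show ?case
    by (simp only:) blast
qed

lemma polylog_props:
  assumes "is_polylog1 \<iota> l1" "1 \<le> n"
  shows "continuous_on UNIV (polylog \<iota> l1 n)" "Fq_linear_O \<iota> (polylog \<iota> l1 n)"
    "Delta_op \<iota> (polylog \<iota> l1 (Suc n)) = polylog \<iota> l1 n"
  using polylog_Suc_props[OF assms(1), of "n - 1"] polylog_Suc_props[OF assms(1), of n] assms(2)
  by simp_all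

section \<open>Fractional derivatives at 1\<close>

lemma Fq_linear_O_X_power_tendsto_0:
  assumes "continuous_on UNIV u" "Fq_linear_O \<iota> u"
  shows "(\<lambda>k. u (fps_X ^ k)) \<longlonglongrightarrow> 0"
proof (rule metric_LIMSEQ_I)
  fix e :: real
  assume "0 < e"
  then obtain M where M: "\<And>s. nrm (u (fps_X ^ M * s)) < e"
    using continuous_on_fps_small[OF assms(1) Fq_linear_O_0[OF assms(2)]] by blast
  have "nrm (u (fps_X ^ k)) < e" if "M \<le> k" for k
    using M[of "fps_X ^ (k - M)"] that by (simp add: power_add[symmetric])
  then show "\<exists>M. \<forall>k\<ge>M. nrm (u (fps_X ^ k)) < e"
    by blast
qed

lemma nrm_frac_Delta_term:
  "nrm (frac_Delta_term \<iota> \<theta> u 1 k) =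
     abs_x (fps_to_fls (hyperdiff k (fps_hat \<theta>))) * nrm (u (fps_X ^ k))"
  unfolding frac_Delta_term_def abs_mult abs_emb nrm_power nrm_minus nrm_one by simp

text \<open>The coefficients D_k(hat theta) are integral, so each term is dominated by
  u(x^k).\<close>

lemma frac_Delta_term_tendsto_0:
  assumes "continuous_on UNIV u" "Fq_linear_O \<iota> u"
  shows "frac_Delta_term \<iota> \<theta> u 1 \<longlonglongrightarrow> 0"
proof (rule metric_tendsto_imp_tendsto[OF Fq_linear_O_X_power_tendsto_0[OF assms]],
    rule always_eventually, rule allI)
  fix k
  have "nrm (frac_Delta_term \<iota> \<theta> u 1 k) \<le> 1 * nrm (u (fps_X ^ k))"
    unfolding nrm_frac_Delta_term by (intro mult_right_mono abs_x_fps_le_1 zero_le_dist)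
  then show "nrm (frac_Delta_term \<iota> \<theta> u 1 k) \<le> nrm (u (fps_X ^ k))"
    by (simp only: mult_1_left)
qed

lemma frac_Delta_sums:
  assumes "continuous_on UNIV u" "Fq_linear_O \<iota> u"
  shows "frac_Delta_term \<iota> \<theta> u 1 sums frac_Delta \<iota> \<theta> u 1"
  unfolding frac_Delta_def
  by (rule summable_sums[OF summable_nrm[OF frac_Delta_term_tendsto_0[OF assms]]])

lemma frac_Delta_add:
  assumes "continuous_on UNIV u" "Fq_linear_O \<iota> u"
  shows "frac_Delta \<iota> (\<theta> + \<eta>) u 1 = frac_Delta \<iota> \<theta> u 1 + frac_Delta \<iota> \<eta> u 1"
proof -
  have "frac_Delta_term \<iota> (\<theta> + \<eta>) u 1 k =
      frac_Delta_term \<iota> \<theta> u 1 k + frac_Delta_term \<iota> \<eta> u 1 k" for k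
    unfolding frac_Delta_term_def fps_hat_add hyperdiff_add fps_to_fls_plus emb_hom
    by (simp only: distrib_left distrib_right)
  then have "frac_Delta_term \<iota> (\<theta> + \<eta>) u 1 =
      (\<lambda>k. frac_Delta_term \<iota> \<theta> u 1 k + frac_Delta_term \<iota> \<eta> u 1 k)"
    by (rule ext)
  with sums_add_nrm[OF frac_Delta_sums[OF assms] frac_Delta_sums[OF assms]]
  have "frac_Delta_term \<iota> (\<theta> + \<eta>) u 1 sums (frac_Delta \<iota> \<theta> u 1 + frac_Delta \<iota> \<eta> u 1)"
    by (simp only:)
  then show ?thesis
    using frac_Delta_sums[OF assms] sums_unique2 by blast
qed

lemma frac_Delta_scale:
  assumes "continuous_on UNIV u" "Fq_linear_O \<iota> u"
  shows "frac_Delta \<iota> (fps_const c * \<theta>) u 1 = \<iota> (fls_const c) * frac_Delta \<iota> \<theta> u 1"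
proof -
  have "frac_Delta_term \<iota> (fps_const c * \<theta>) u 1 k =
      \<iota> (fls_const c) * frac_Delta_term \<iota> \<theta> u 1 k" for k
    unfolding frac_Delta_term_def fps_hat_const_mult hyperdiff_const_mult fls_times_fps_to_fls
      emb_hom fps_const_to_fls
    by (simp only: mult_ac)
  then have "frac_Delta_term \<iota> (fps_const c * \<theta>) u 1 =
      (\<lambda>k. \<iota> (fls_const c) * frac_Delta_term \<iota> \<theta> u 1 k)"
    by (rule ext)
  with sums_mult_nrm[OF frac_Delta_sums[OF assms]]
  have "frac_Delta_term \<iota> (fps_const c * \<theta>) u 1 sums (\<iota> (fls_const c) * frac_Delta \<iota> \<theta> u 1)"
    by (simp only:)
  then show ?thesis
    using frac_Delta_sums[OF assms] sums_unique2 by blast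
qed

text \<open>All D_k 1 with k > 0 vanish. This evaluates zeta at x^(-n).\<close>

lemma frac_Delta_one: "frac_Delta \<iota> 1 u 1 = u 1"
proof -
  have "frac_Delta_term \<iota> 1 u 1 k = (if k = 0 then u 1 else 0)" for k
    by (simp add: frac_Delta_term_def fps_hat_one hyperdiff_one emb_hom)
  then have "frac_Delta_term \<iota> 1 u 1 = (\<lambda>k. if k = 0 then u 1 else 0)"
    by (rule ext)
  then show ?thesis
    unfolding frac_Delta_def using sums_unique[OF sums_single[of 0 "\<lambda>_. u 1"]] by simp
qed

text \<open>
  The Leibniz rule \<open>D_{k+1}(x f) = x D_{k+1} f + D_k f\<close> makes the partial sums of the two series
  agree up to the boundary term \<open>x\<close> times the last summand.
\<close>

lemma frac_Delta_X_mult: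
  assumes u: "continuous_on UNIV u" "Fq_linear_O \<iota> u"
    and v: "continuous_on UNIV v" "Fq_linear_O \<iota> v"
    and Del: "Delta_op \<iota> u = v"
  shows "frac_Delta \<iota> (fps_X * \<theta>) u 1 = frac_Delta \<iota> \<theta> v 1"
proof -
  define T where "T = frac_Delta_term \<iota> (fps_X * \<theta>) u 1"
  define a where "a = frac_Delta_term \<iota> \<theta> u 1"
  define b where "b = frac_Delta_term \<iota> \<theta> v 1"
  define c where "c k = (-1) ^ k * \<iota> (fps_to_fls (hyperdiff k (fps_hat \<theta>)))" for k
  have a: "a k = c k * u (fps_X ^ k)" for k
    by (simp add: a_def frac_Delta_term_def c_def)
  have b: "b k = c k * u (fps_X ^ Suc k) - \<iota> fls_X * a k" for k
    unfolding a Del[symmetric] b_def c_def frac_Delta_term_def Delta_op_def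
    by (simp add: right_diff_distrib mult_ac)
  have T0: "T 0 = - (\<iota> fls_X * a 0)"
    unfolding T_def a c_def frac_Delta_term_def fps_hat_X_mult hyperdiff_0
    by (simp add: emb_hom fls_times_fps_to_fls)
  \<comment> \<open>The extra sign of (-1)^(k+1) cancels the one from the hat of x theta in the D_k
    part, while the D_(k+1) part keeps a minus sign as a multiple of
    \<open>a (Suc k)\<close>.\<close>
  have T_Suc: "T (Suc k) = c k * u (fps_X ^ Suc k) - \<iota> fls_X * a (Suc k)" for k
    unfolding T_def a c_def frac_Delta_term_def fps_hat_X_mult hyperdiff_minus
      hyperdiff_Suc_X_mult fps_to_fls_uminus fps_to_fls_plus fls_times_fps_to_fls fps_X_to_fls emb_hom
    by (simp add: algebra_simps)
  have partial: "sum T {..<Suc N} = sum b {..<N} + (- \<iota> fls_X) * a N" for N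
    by (induction N) (simp_all add: T0 T_Suc b algebra_simps)
  have "(\<lambda>N. sum b {..<N} + (- \<iota> fls_X) * a N) \<longlonglongrightarrow> frac_Delta \<iota> \<theta> v 1 + (- \<iota> fls_X) * 0"
  proof (rule tendsto_add_nrm)
    show "(\<lambda>N. sum b {..<N}) \<longlonglongrightarrow> frac_Delta \<iota> \<theta> v 1"
      using frac_Delta_sums[OF v] by (simp only: b_def sums_def)
    show "(\<lambda>N. (- \<iota> fls_X) * a N) \<longlonglongrightarrow> (- \<iota> fls_X) * 0"
      unfolding a_def by (intro tendsto_mult_left_nrm frac_Delta_term_tendsto_0 u)
  qed
  then have "(\<lambda>N. sum T {..<Suc N}) \<longlonglongrightarrow> frac_Delta \<iota> \<theta> v 1"
    unfolding partial by simp
  moreover have "(\<lambda>N. sum T {..<Suc N}) \<longlonglongrightarrow> frac_Delta \<iota> (fps_X * \<theta>) u 1"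
    using frac_Delta_sums[OF u] unfolding T_def sums_def by (rule LIMSEQ_Suc)
  ultimately show ?thesis
    using LIMSEQ_unique by blast
qed

text \<open>The index is split at \<open>N\<close>: beyond it the values u(x^k) are small; below it
  D_k leaves at least \<open>m\<close> of the \<open>m + N\<close> factors x, and the values of u
  are bounded by \<open>B\<close>.\<close>

lemma frac_Delta_small:
  assumes u: "continuous_on UNIV u" "Fq_linear_O \<iota> u" and "0 < e"
  shows "\<exists>M. \<forall>s. nrm (frac_Delta \<iota> (fps_X ^ M * s) u 1) < e"
proof -
  note lim = Fq_linear_O_X_power_tendsto_0[OF u]
  obtain N where N: "\<And>k. N \<le> k \<Longrightarrow> nrm (u (fps_X ^ k)) < e / 2"
    using metric_LIMSEQ_D[OF lim, of "e / 2"] \<open>0 < e\<close> by auto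
  obtain B where B: "\<And>k. nrm (u (fps_X ^ k)) \<le> B"
    using convergent_imp_bounded[OF lim] unfolding bounded_any_center[where a=0]
    by (auto simp: dist_commute)
  have B0: "0 \<le> B"
    using B[of 0] zero_le_dist order.trans by blast
  \<comment> \<open>\<open>B + 1\<close> avoids dividing by zero when \<open>B = 0\<close>.\<close>
  obtain m where m: "(1 / real CARD('a)) ^ m < e / 2 / (B + 1)"
    using real_arch_pow_inv[of "e / 2 / (B + 1)" "1 / real CARD('a)"] \<open>0 < e\<close> B0
      CARD_field_gt_1[where 'a='a] by auto
  have mB: "(1 / real CARD('a)) ^ m * B \<le> e / 2"
  proof -
    have "(1 / real CARD('a)) ^ m * B \<le> (1 / real CARD('a)) ^ m * (B + 1)"
      by (intro mult_left_mono) auto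
    also have "\<dots> \<le> e / 2"
      using m[THEN less_imp_le] B0 by (subst (asm) pos_le_divide_eq) simp_all
    finally show ?thesis .
  qed
  have "nrm (frac_Delta \<iota> (fps_X ^ (m + N) * s) u 1) \<le> e / 2" for s
  proof (rule nrm_sums_le[OF frac_Delta_sums[OF u]])
    fix k
    let ?d = "abs_x (fps_to_fls (hyperdiff k (fps_hat (fps_X ^ (m + N) * s))))"
    have "?d * nrm (u (fps_X ^ k)) \<le> e / 2"
    proof (cases "N \<le> k")
      case True
      have "?d * nrm (u (fps_X ^ k)) \<le> 1 * nrm (u (fps_X ^ k))"
        by (intro mult_right_mono abs_x_fps_le_1 zero_le_dist)
      with N[OF True] show ?thesis by simp
    next
      case False
      then have "fps_X ^ (m + N) * s = fps_X ^ (m + k) * (fps_X ^ (N - k) * s)"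
        by (simp add: power_add[symmetric] mult.assoc[symmetric])
      then obtain g where "hyperdiff k (fps_hat (fps_X ^ (m + N) * s)) = fps_X ^ m * g"
        using hyperdiff_X_power_mult fps_hat_X_power_mult by metis
      then have "?d \<le> (1 / real CARD('a)) ^ m"
        using abs_x_fps_X_power_mult_le by metis
      then have "?d * nrm (u (fps_X ^ k)) \<le> (1 / real CARD('a)) ^ m * B"
        using B by (intro mult_mono) auto
      with mB show ?thesis by simp
    qed
    then show "nrm (frac_Delta_term \<iota> (fps_X ^ (m + N) * s) u 1 k) \<le> e / 2"
      unfolding nrm_frac_Delta_term .
  qed
  moreover have "e / 2 < e"
    using \<open>0 < e\<close> by simp
  ultimately show ?thesis
    using order.strict_trans1 by blast
qed

section \<open>The function zeta\<close>

lemma zeta_representation_indep: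
  assumes l1: "is_polylog1 \<iota> l1" and "1 \<le> n"
  shows "frac_Delta \<iota> (fps_X ^ k * \<theta>) (polylog \<iota> l1 (n + k)) 1 = frac_Delta \<iota> \<theta> (polylog \<iota> l1 n) 1"
proof (induction k)
  case (Suc k)
  have "frac_Delta \<iota> (fps_X * (fps_X ^ k * \<theta>)) (polylog \<iota> l1 (Suc (n + k))) 1 =
      frac_Delta \<iota> (fps_X ^ k * \<theta>) (polylog \<iota> l1 (n + k)) 1"
    using \<open>1 \<le> n\<close> by (intro frac_Delta_X_mult polylog_props[OF l1]) auto
  with Suc show ?case
    by (simp only: add_Suc_right power_Suc mult.assoc)
qed simp

lemma zeta_value_unique:
  assumes l1: "is_polylog1 \<iota> l1" and "1 \<le> n" "zeta_value \<iota> l1 (fls_X_inv ^ n * fps_to_fls \<theta>) z"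
  shows "z = frac_Delta \<iota> \<theta> (polylog \<iota> l1 n) 1"
proof -
  \<comment> \<open>For \<open>n \<le> m\<close>, cancelling x^(-m) shows that \<open>\<eta>\<close>
    is x^(m-n) times \<open>\<theta>\<close>. The fact is applied in either order below.\<close>
  have aux: "frac_Delta \<iota> \<theta> (polylog \<iota> l1 n) 1 = frac_Delta \<iota> \<eta> (polylog \<iota> l1 m) 1"
    if "1 \<le> n" "n \<le> m" "fls_X_inv ^ n * fps_to_fls \<theta> = fls_X_inv ^ m * fps_to_fls \<eta>"
    for n m :: nat and \<theta> \<eta>
  proof -
    have m: "m = n + (m - n)"
      using that by simp
    then have "fls_X_inv ^ m * fps_to_fls \<eta> = fls_X_inv ^ m * fps_to_fls (fps_X ^ (m - n) * \<theta>)"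
      using fls_X_inv_power_mult_X_power[of n "m - n" \<theta>] that by metis
    then have "\<eta> = fps_X ^ (m - n) * \<theta>"
      by simp
    with m zeta_representation_indep[OF l1 that(1), of "m - n" \<theta>] show ?thesis
      by metis
  qed
  obtain m \<eta> where m: "1 \<le> m" "fls_X_inv ^ n * fps_to_fls \<theta> = fls_X_inv ^ m * fps_to_fls \<eta>"
    "z = frac_Delta \<iota> \<eta> (polylog \<iota> l1 m) 1"
    using assms(3) unfolding zeta_value_def by blast
  show ?thesis
    using aux[of n m \<theta> \<eta>] aux[of m n \<eta> \<theta>] m assms(2) by (cases "n \<le> m") auto
qed

text \<open>Makes every representation usable for computing zeta. At 0 the value is set by
  convention, and additivity shows that the formula also gives 0 there.\<close>

lemma zeta_eq:
  assumes l1: "is_polylog1 \<iota> l1" and "1 \<le> n"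
  shows "zeta \<iota> l1 (fls_X_inv ^ n * fps_to_fls \<theta>) = frac_Delta \<iota> \<theta> (polylog \<iota> l1 n) 1"
proof (cases "\<theta> = 0")
  case True
  have "frac_Delta \<iota> (0 + 0) (polylog \<iota> l1 n) 1 =
      frac_Delta \<iota> 0 (polylog \<iota> l1 n) 1 + frac_Delta \<iota> 0 (polylog \<iota> l1 n) 1"
    by (intro frac_Delta_add polylog_props assms)
  then have "frac_Delta \<iota> 0 (polylog \<iota> l1 n) 1 = 0"
    by (metis add_0 add_cancel_right_right)
  with True show ?thesis
    by (simp add: zeta_def)
next
  case False
  have "zeta_value \<iota> l1 (fls_X_inv ^ n * fps_to_fls \<theta>) (frac_Delta \<iota> \<theta> (polylog \<iota> l1 n) 1)"
    unfolding zeta_value_def using \<open>1 \<le> n\<close> by blast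
  then have "(THE z. zeta_value \<iota> l1 (fls_X_inv ^ n * fps_to_fls \<theta>) z) =
      frac_Delta \<iota> \<theta> (polylog \<iota> l1 n) 1"
    using zeta_value_unique[OF assms] by (rule the_equality)
  with False show ?thesis
    by (simp add: zeta_def)
qed

lemma zeta_add:
  assumes l1: "is_polylog1 \<iota> l1"
  shows "zeta \<iota> l1 (s + t) = zeta \<iota> l1 s + zeta \<iota> l1 t"
proof -
  \<comment> \<open>One exponent for both arguments: \<open>nat\<close> truncates the irrelevant
    negative values, and \<open>Suc\<close> ensures n >= 1.\<close>
  define n where "n = Suc (nat (- fls_subdegree s) + nat (- fls_subdegree t))"
  have "- int n \<le> fls_subdegree s" "- int n \<le> fls_subdegree t"
    unfolding n_def by linarith+
  then obtain \<theta> \<eta> where st: "s = fls_X_inv ^ n * fps_to_fls \<theta>" "t = fls_X_inv ^ n * fps_to_fls \<eta>"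
    by (metis fls_X_inv_power_decompose)
  then have "s + t = fls_X_inv ^ n * fps_to_fls (\<theta> + \<eta>)"
    by (simp add: distrib_left)
  moreover have "1 \<le> n"
    by (simp add: n_def)
  ultimately show ?thesis
    unfolding st by (simp only: zeta_eq[OF l1] frac_Delta_add polylog_props[OF l1])
qed

lemma zeta_scale:
  assumes l1: "is_polylog1 \<iota> l1"
  shows "zeta \<iota> l1 (fls_const c * t) = \<iota> (fls_const c) * zeta \<iota> l1 t"
proof -
  define n where "n = Suc (nat (- fls_subdegree t))"
  have "- int n \<le> fls_subdegree t"
    unfolding n_def by linarith
  then obtain \<theta> where t: "t = fls_X_inv ^ n * fps_to_fls \<theta>"
    by (rule fls_X_inv_power_decompose)
  then have "fls_const c * t = fls_X_inv ^ n * fps_to_fls (fps_const c * \<theta>)"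
    by (simp add: fls_times_fps_to_fls mult_ac)
  moreover have "1 \<le> n"
    by (simp add: n_def)
  ultimately show ?thesis
    unfolding t by (simp only: zeta_eq[OF l1] frac_Delta_scale polylog_props[OF l1])
qed

lemma continuous_on_zeta:
  assumes l1: "is_polylog1 \<iota> l1"
  shows "continuous_on UNIV (zeta \<iota> l1)"
  unfolding continuous_on_iff
proof (intro ballI allI impI)
  fix t :: "'a fls" and e :: real
  assume "0 < e"
  then obtain M where M: "\<And>s. nrm (frac_Delta \<iota> (fps_X ^ M * s) (polylog \<iota> l1 1) 1) < e"
    using frac_Delta_small polylog_props[OF l1] by (metis order_refl)
  show "\<exists>d>0. \<forall>t'\<in>UNIV. dist t' t < d \<longrightarrow> dist (zeta \<iota> l1 t') (zeta \<iota> l1 t) < e"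
  proof (intro exI conjI ballI impI)
    show "(0::real) < inverse (2 ^ M)"
      by simp
    fix t' :: "'a fls"
    assume "dist t' t < inverse (2 ^ M)"
    \<comment> \<open>For subdegree d of a nonzero difference, the library distance is 2^(-d) if d
      >= 0 and 2^(-d) >= 1 otherwise, so a distance below 2^(-M) forces d > M.\<close>
    have sub: "t' - t = 0 \<or> int M < fls_subdegree (t' - t)"
    proof (rule ccontr)
      assume neg: "\<not> ?thesis"
      then have "inverse (2 ^ M) \<le> dist t' t"
      proof (cases "0 \<le> fls_subdegree (t' - t)")
        case True
        then have "nat (fls_subdegree (t' - t)) \<le> M"
          using neg by linarith
        then have "inverse (2 ^ M :: real) \<le> inverse (2 ^ nat (fls_subdegree (t' - t)))"
          by (intro le_imp_inverse_le power_increasing) auto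
        with True neg show ?thesis
          by (simp add: dist_fls_def)
      next
        case False
        have "inverse (2 ^ M :: real) \<le> 1"
          by (simp add: inverse_le_1_iff)
        also have "(1::real) \<le> 2 ^ nat (- fls_subdegree (t' - t))"
          by simp
        finally show ?thesis
          using False neg by (simp add: dist_fls_def)
      qed
      with \<open>dist t' t < inverse (2 ^ M)\<close> show False by simp
    qed
    then have "- int 1 \<le> fls_subdegree (t' - t)"
      by auto
    then obtain \<theta> where \<theta>: "t' - t = fls_X_inv ^ 1 * fps_to_fls \<theta>"
      by (rule fls_X_inv_power_decompose)
    \<comment> \<open>Passing from the difference to \<open>\<theta>\<close> raises the subdegree by
      one, so the \<open>M\<close> factors x are certainly present.\<close>
    have "\<theta> = 0 \<or> M \<le> subdegree \<theta>"
    proof (cases "\<theta> = 0")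
      case False
      then have "fls_subdegree (t' - t) = int (subdegree \<theta>) - 1"
        unfolding \<theta> power_one_right
        by (subst fls_subdegree_mult_fls_X_inv) (simp_all add: fls_subdegree_fls_to_fps)
      moreover have "t' - t \<noteq> 0"
        using False by (simp add: \<theta>)
      ultimately show ?thesis
        using sub by linarith
    qed simp
    then obtain s where "\<theta> = fps_X ^ M * s"
      by (rule fps_eq_X_power_mult)
    then have "nrm (zeta \<iota> l1 (t' - t)) < e"
      unfolding \<theta> using M by (simp only: zeta_eq[OF l1] order_refl)
    moreover have "zeta \<iota> l1 t' - zeta \<iota> l1 t = zeta \<iota> l1 (t' - t)"
      using zeta_add[OF l1, of t "t' - t"] by simp
    ultimately show "dist (zeta \<iota> l1 t') (zeta \<iota> l1 t) < e"
      by (simp add: dist_eq[of "zeta \<iota> l1 t'"])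
  qed
qed

end

theorem mainTheorem3:
  fixes \<iota> :: "'a::{field,finite} fls \<Rightarrow> 'o::{field,complete_space}"
    and l1 :: "'a fps \<Rightarrow> 'o"
  assumes "completed_alg_closure \<iota>"
    and "is_polylog1 \<iota> l1"
  shows "(\<forall>n\<ge>1. \<forall>\<theta>. summable (frac_Delta_term \<iota> \<theta> (polylog \<iota> l1 n) 1)) \<and>
         (\<forall>t. t \<noteq> 0 \<longrightarrow> (\<exists>!z. zeta_value \<iota> l1 t z)) \<and>
         (\<forall>n\<ge>1. zeta \<iota> l1 (fls_X_inv ^ n) = polylog \<iota> l1 n 1) \<and>
         continuous_on UNIV (zeta \<iota> l1) \<and>
         Fq_linear_K \<iota> (zeta \<iota> l1)"
proof (intro conjI allI impI)
  interpret completed_alg_closure \<iota> by fact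
  note l1 = \<open>is_polylog1 \<iota> l1\<close>
  show "summable (frac_Delta_term \<iota> \<theta> (polylog \<iota> l1 n) 1)" if "1 \<le> n" for n \<theta>
    using frac_Delta_sums[OF polylog_props(1,2)[OF l1 that]] by (rule sums_summable)
  show "\<exists>!z. zeta_value \<iota> l1 t z" for t
  proof -
    define n where "n = Suc (nat (- fls_subdegree t))"
    have n: "1 \<le> n"
      by (simp add: n_def)
    have "- int n \<le> fls_subdegree t"
      unfolding n_def by linarith
    then obtain \<theta> where t: "t = fls_X_inv ^ n * fps_to_fls \<theta>"
      by (rule fls_X_inv_power_decompose)
    have "zeta_value \<iota> l1 t (frac_Delta \<iota> \<theta> (polylog \<iota> l1 n) 1)"
      unfolding zeta_value_def using n t by blast
    then show ?thesis
      using zeta_value_unique[OF l1 n] unfolding t by blast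
  qed
  show "zeta \<iota> l1 (fls_X_inv ^ n) = polylog \<iota> l1 n 1" if "1 \<le> n" for n
    using zeta_eq[OF l1 that, of 1] by (simp add: frac_Delta_one)
  show "continuous_on UNIV (zeta \<iota> l1)"
    using l1 by (rule continuous_on_zeta)
  show "Fq_linear_K \<iota> (zeta \<iota> l1)"
    unfolding Fq_linear_K_iff using zeta_add[OF l1] zeta_scale[OF l1] by blast
qed

end
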